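(* For a topoframe $L_\tau=(L,\tau)$, the ring $\mathcal{R}L_\tau$ is regular if and only if it is $\aleph_0$-selfinjective.
   Context: A frame is a complete lattice $L$ (top $\top$, bottom $\bot$) with $a\wedge\bigvee S=\bigvee\{a\wedge s: s\in S\}$ for all $a\in L$, $S\subseteq L$. A frame homomorphism preserves finite meets (including $\top$) and arbitrary joins (including $\bot$). A topoframe $L_\tau$ is a pair $(L,\tau)$ where $L$ is a frame and $\tau$ is a subframe of $L$ all of whose elements are complemented in $L$. A real-continuous function on $L_\tau$ is a frame homomorphism $f:\mathcal{P}(\mathbb{R})\to L$ (where $\mathcal P(\mathbb R)$ is the power set of $\mathbb R$) such that $f(\{x\in\mathbb R: p<x<q\})\in\tau$ for all $p,q\in\mathbb{Q}$. $\mathcal{R}L_\tau$ is the set of all these; it is a commutative (reduced) ring with identity under $(f\diamond g)(X)=\bigvee\{f(Y)\wedge g(Z): Y\diamond Z\subseteq X\}$ for $\diamond\in\{+,\cdot\}$, where $Y\diamond Z=\{y\diamond z: y\in Y, z\in Z\}$, with $(-f)(X)=f(-X)$, and with the constants $\mathbf{r}$ ($r\in\mathbb R$) given by $\mathbf r(X)=\top$ if $r\in X$ and $\bot$ otherwise; $\mathbf 0$ and $\mathbf 1$ are the zero and identity. A commutative ring $A$ with identity is regular (in the sense of von Neumann) if for every $x\in A$ there is $y\in A$ with $x=x^2y$. It is $\aleph_0$-selfinjective if every $A$-homomorphism from a countably generated ideal of $A$ to $A$ can be extended to an $A$-homomorphism from $A$ to $A$. *)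

theory Defs
  imports "HOL-Analysis.Product_Vector" "HOL-Library.Countable_Set" "HOL-Algebra.Ideal"
begin

hide_const (open) Order.top Order.bottom Lattice.sup Lattice.inf

section \<open>Frames and topoframes\<close>

text \<open>
  The distribution has no class for frames: \<^class>\<open>complete_distrib_lattice\<close> means complete
  distributivity, which is strictly stronger.
\<close>

class frame = complete_lattice +
  assumes inf_Sup_distrib: "inf a (Sup S) = (SUP s\<in>S. inf a s)"

instance set :: (type) frame
  by standard auto

definition frame_hom :: "('a::frame \<Rightarrow> 'b::frame) \<Rightarrow> bool" where
  "frame_hom f \<longleftrightarrow>
     f top = top \<and> (\<forall>x y. f (inf x y) = inf (f x) (f y)) \<and> (\<forall>S. f (Sup S) = Sup (f ` S))"

definition subframe :: "'a::frame set \<Rightarrow> bool" where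
  "subframe T \<longleftrightarrow>
     top \<in> T \<and> (\<forall>x\<in>T. \<forall>y\<in>T. inf x y \<in> T) \<and> (\<forall>S. S \<subseteq> T \<longrightarrow> Sup S \<in> T)"

definition complemented :: "'a::frame \<Rightarrow> bool" where
  "complemented x \<longleftrightarrow> (\<exists>y. inf x y = bot \<and> sup x y = top)"

text \<open>The frame \<open>L\<close> of a topoframe \<open>(L, T)\<close> is the whole carrier type of \<open>T\<close>.\<close>

definition topoframe :: "'a::frame set \<Rightarrow> bool" where
  "topoframe T \<longleftrightarrow> subframe T \<and> (\<forall>x\<in>T. complemented x)"


section \<open>The ring of real-continuous functions\<close>

definition real_continuous :: "'a::frame set \<Rightarrow> (real set \<Rightarrow> 'a) \<Rightarrow> bool" where
  "real_continuous T f \<longleftrightarrow> frame_hom f \<and> (\<forall>p\<in>\<rat>. \<forall>q\<in>\<rat>. f {p<..<q} \<in> T)"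

definition rc_lift ::
    "(real \<Rightarrow> real \<Rightarrow> real) \<Rightarrow> (real set \<Rightarrow> 'a::frame) \<Rightarrow> (real set \<Rightarrow> 'a) \<Rightarrow> real set \<Rightarrow> 'a" where
  "rc_lift d f g X = Sup {inf (f Y) (g Z) |Y Z. {d y z |y z. y \<in> Y \<and> z \<in> Z} \<subseteq> X}"

definition rc_const :: "real \<Rightarrow> real set \<Rightarrow> 'a::frame" where
  "rc_const r X = (if r \<in> X then top else bot)"

definition rc_ring :: "'a::frame set \<Rightarrow> (real set \<Rightarrow> 'a) ring" where
  "rc_ring T =
     \<lparr>carrier = {f. real_continuous T f}, mult = rc_lift (*), one = rc_const 1,
      zero = rc_const 0, add = rc_lift (+)\<rparr>"


section \<open>Regular and countably self-injective rings\<close>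

locale regular_cring = cring +
  assumes regular: "x \<in> carrier R \<Longrightarrow> \<exists>y\<in>carrier R. x = x [^] (2::nat) \<otimes> y"

text \<open>\<open>R\<close>-homomorphisms from an ideal \<open>I\<close> to \<open>R\<close>; values outside \<open>I\<close> are irrelevant.\<close>

definition ideal_hom :: "('a, 'm) ring_scheme \<Rightarrow> 'a set \<Rightarrow> ('a \<Rightarrow> 'a) \<Rightarrow> bool" where
  "ideal_hom R I h \<longleftrightarrow>
     h \<in> I \<rightarrow> carrier R \<and>
     (\<forall>x\<in>I. \<forall>y\<in>I. h (x \<oplus>\<^bsub>R\<^esub> y) = h x \<oplus>\<^bsub>R\<^esub> h y) \<and>
     (\<forall>a\<in>carrier R. \<forall>x\<in>I. h (a \<otimes>\<^bsub>R\<^esub> x) = a \<otimes>\<^bsub>R\<^esub> h x)"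

definition countably_generated_ideal :: "('a, 'm) ring_scheme \<Rightarrow> 'a set \<Rightarrow> bool" where
  "countably_generated_ideal R I \<longleftrightarrow> (\<exists>S. countable S \<and> S \<subseteq> carrier R \<and> I = Idl\<^bsub>R\<^esub> S)"

locale aleph0_selfinjective = cring +
  assumes extend: "countably_generated_ideal R I \<Longrightarrow> ideal_hom R I h \<Longrightarrow>
    \<exists>k. ideal_hom R (carrier R) k \<and> (\<forall>x\<in>I. k x = h x)"


section \<open>The real-continuous functions form a commutative ring\<close>

text \<open>A frame homomorphism on \<open>\<P>(\<real>)\<close> amounts to a partition of the top element indexed by \<open>\<real>\<close>.\<close>

lemma SUP_inf_frame: "inf (SUP i\<in>I. u i) a = (SUP i\<in>I. inf (u i) (a::'a::frame))"
  by (simp add: inf_commute[of _ a] inf_Sup_distrib image_image)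

lemma inf_SUP_frame: "inf a (SUP i\<in>I. u i) = (SUP i\<in>I. inf (a::'a::frame) (u i))"
  by (simp add: inf_Sup_distrib image_image)

lemma frame_homD:
  assumes "frame_hom f"
  shows "f top = top" "f (inf x y) = inf (f x) (f y)" "f (Sup S) = Sup (f ` S)" "f bot = bot"
proof -
  show "f top = top" "f (inf x y) = inf (f x) (f y)" "f (Sup S) = Sup (f ` S)"
    using assms by (auto simp: frame_hom_def)
  have "f (Sup {}) = Sup (f ` {})"
    using assms unfolding frame_hom_def by blast
  then show "f bot = bot" by simp
qed

lemma frame_hom_mono:
  assumes "frame_hom f" "x \<le> y"
  shows "f x \<le> f y"
  using frame_homD(2)[OF assms(1), of x y] assms(2) by (metis inf.absorb1 inf.cobounded2)

lemma frame_hom_points: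
  fixes f :: "real set \<Rightarrow> 'a::frame"
  assumes "frame_hom f"
  shows "f X = (SUP x\<in>X. f {x})"
  using frame_homD(3)[OF assms, of "(\<lambda>x. {x}) ` X"] by (simp add: image_image)

lemma frame_hom_disjoint:
  fixes f :: "real set \<Rightarrow> 'a::frame"
  assumes "frame_hom f" "X \<inter> Y = {}"
  shows "inf (f X) (f Y) = bot"
  using frame_homD(2)[OF assms(1), of X Y] frame_homD(4)[OF assms(1)] assms(2)
  by simp

lemma frame_hom_eqI:
  fixes f g h F G :: "real set \<Rightarrow> 'a::frame"
  assumes hom: "frame_hom f" "frame_hom g" "frame_hom h" "frame_hom F" "frame_hom G"
    and le: "\<And>x y z. \<exists>r. inf (inf (f {x}) (g {y})) (h {z}) \<le> inf (F {r}) (G {r})"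
  shows "F = G"
proof -
  have aux: "F X \<le> G X"
    if hom': "frame_hom F" "frame_hom G"
      and le': "\<And>x y z. \<exists>r. inf (inf (f {x}) (g {y})) (h {z}) \<le> inf (F {r}) (G {r})"
    for F G :: "real set \<Rightarrow> 'a" and X
  proof -
    let ?c = "\<lambda>x y z. inf (inf (f {x}) (g {y})) (h {z})"
    have "inf (F X) (?c x y z) \<le> G X" for x y z
    proof -
      obtain r where r: "?c x y z \<le> inf (F {r}) (G {r})" using le' by blast
      show ?thesis
      proof (cases "r \<in> X")
        case True
        have "G {r} \<le> G X" using True by (simp add: frame_hom_mono[OF hom'(2)])
        then show ?thesis using r by (meson inf.cobounded2 le_infE order_trans)
      next
        case False
        then have "inf (F X) (F {r}) = bot" by (simp add: frame_hom_disjoint[OF hom'(1)])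
        then have "inf (F X) (?c x y z) \<le> bot"
          using r by (metis inf_mono le_infE order_refl)
        then show ?thesis by (simp add: bot_unique)
      qed
    qed
    then have "inf (F X) (inf (inf (f UNIV) (g UNIV)) (h UNIV)) \<le> G X"
      unfolding frame_hom_points[OF hom(1), of UNIV] frame_hom_points[OF hom(2), of UNIV]
        frame_hom_points[OF hom(3), of UNIV]
      by (simp add: SUP_inf_frame inf_SUP_frame SUP_le_iff)
    then show ?thesis using hom by (simp add: frame_homD(1))
  qed
  show ?thesis
    by (intro ext order.antisym aux hom) (use le in \<open>auto simp: inf_commute[of "G _"]\<close>)
qed

lemma rc_lift_points:
  fixes f g :: "real set \<Rightarrow> 'a::frame"
  assumes "frame_hom f" "frame_hom g"
  shows "rc_lift d f g X = (SUP (y, z) \<in> {(y, z). d y z \<in> X}. inf (f {y}) (g {z}))"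
proof (rule order.antisym)
  show "rc_lift d f g X \<le> (SUP (y, z) \<in> {(y, z). d y z \<in> X}. inf (f {y}) (g {z}))" (is "_ \<le> ?R")
    unfolding rc_lift_def
  proof (rule Sup_least, clarify)
    fix Y Z assume YZ: "{d y z |y z. y \<in> Y \<and> z \<in> Z} \<subseteq> X"
    have "inf (f {y}) (g {z}) \<le> ?R" if "y \<in> Y" "z \<in> Z" for y z
      using YZ that by (intro SUP_upper2[of "(y, z)"]) auto
    then show "inf (f Y) (g Z) \<le> ?R"
      unfolding frame_hom_points[OF assms(1), of Y] frame_hom_points[OF assms(2), of Z]
      by (simp add: SUP_inf_frame inf_Sup_distrib image_image SUP_le_iff)
  qed
  show "?R \<le> rc_lift d f g X"
    unfolding rc_lift_def
  proof (rule SUP_least, clarify)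
    fix y z assume "d y z \<in> X"
    then show "inf (f {y}) (g {z}) \<le>
        Sup {inf (f Y) (g Z) |Y Z. {d y z |y z. y \<in> Y \<and> z \<in> Z} \<subseteq> X}"
      by (intro Sup_upper CollectI exI[of _ "{y}"] exI[of _ "{z}"]) auto
  qed
qed

lemma rc_lift_upper:
  fixes f g :: "real set \<Rightarrow> 'a::frame"
  assumes "d y z \<in> X"
  shows "inf (f {y}) (g {z}) \<le> rc_lift d f g X"
  unfolding rc_lift_def
  by (intro Sup_upper CollectI exI[of _ "{y}"] exI[of _ "{z}"]) (use assms in auto)

lemma rc_lift_inf_least:
  fixes f g :: "real set \<Rightarrow> 'a::frame"
  assumes "frame_hom f" "frame_hom g"
    and "\<And>y z. d y z \<in> X \<Longrightarrow> inf (inf (f {y}) (g {z})) a \<le> b"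
  shows "inf (rc_lift d f g X) a \<le> b"
  unfolding rc_lift_points[OF assms(1,2)] SUP_inf_frame
  by (rule SUP_least) (use assms(3) in auto)

lemma frame_hom_rc_lift:
  fixes f g :: "real set \<Rightarrow> 'a::frame"
  assumes f: "frame_hom f" and g: "frame_hom g"
  shows "frame_hom (rc_lift d f g)"
proof -
  have "top = inf (f UNIV) (g UNIV)" using f g by (simp add: frame_homD(1))
  also have "\<dots> \<le> rc_lift d f g UNIV"
    unfolding rc_lift_def by (intro Sup_upper) blast
  finally have 1: "rc_lift d f g top = top" by (simp add: top_unique)
  have mono: "rc_lift d f g X \<le> rc_lift d f g Y" if "X \<subseteq> Y" for X Y
    unfolding rc_lift_def using that by (intro Sup_subset_mono) blast
  have 2: "rc_lift d f g (inf X Y) = inf (rc_lift d f g X) (rc_lift d f g Y)" for X Y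
  proof (rule order.antisym)
    show "rc_lift d f g (inf X Y) \<le> inf (rc_lift d f g X) (rc_lift d f g Y)"
      by (simp add: mono)
    have "inf (inf (f {y}) (g {z})) (inf (f {y'}) (g {z'})) \<le> rc_lift d f g (X \<inter> Y)"
      if "d y z \<in> X" "d y' z' \<in> Y" for y z y' z'
    proof (cases "y = y' \<and> z = z'")
      case True
      then show ?thesis
        using that rc_lift_upper[of d y z "X \<inter> Y" f g] by auto
    next
      case False
      have "inf (inf (f {y}) (g {z})) (inf (f {y'}) (g {z'}))
          = inf (inf (f {y}) (f {y'})) (inf (g {z}) (g {z'}))"
        by (simp add: ac_simps)
      also have "\<dots> = bot"
        using False frame_hom_disjoint[OF f, of "{y}" "{y'}"]
          frame_hom_disjoint[OF g, of "{z}" "{z'}"] by auto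
      finally show ?thesis by simp
    qed
    then have "inf (rc_lift d f g Y) (inf (f {y}) (g {z})) \<le> rc_lift d f g (X \<inter> Y)"
      if "d y z \<in> X" for y z
      using that by (intro rc_lift_inf_least[OF f g]) (metis inf_commute)
    then show "inf (rc_lift d f g X) (rc_lift d f g Y) \<le> rc_lift d f g (inf X Y)"
      by (intro rc_lift_inf_least[OF f g]) (metis inf_commute)
  qed
  have 3: "rc_lift d f g (Sup S) = Sup (rc_lift d f g ` S)" for S
  proof (rule order.antisym)
    show "rc_lift d f g (Sup S) \<le> Sup (rc_lift d f g ` S)"
      unfolding rc_lift_points[OF f g, of d "Sup S"]
    proof (rule SUP_least, clarify)
      fix y z X assume "X \<in> S" "d y z \<in> X"
      then show "inf (f {y}) (g {z}) \<le> Sup (rc_lift d f g ` S)"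
        by (intro SUP_upper2[of X] rc_lift_upper)
    qed
    show "Sup (rc_lift d f g ` S) \<le> rc_lift d f g (Sup S)"
      by (intro SUP_least mono) auto
  qed
  show ?thesis
    unfolding frame_hom_def using 1 2 3 by blast
qed

lemma rational_interval_in_open:
  fixes A :: "real set"
  assumes "open A" "y \<in> A"
  shows "\<exists>p\<in>\<rat>. \<exists>q\<in>\<rat>. y \<in> {p<..<q} \<and> {p<..<q} \<subseteq> A"
proof -
  obtain e where e: "e > 0" "\<And>x. dist x y < e \<Longrightarrow> x \<in> A"
    using assms unfolding open_dist by blast
  obtain p where p: "p \<in> \<rat>" "y - e < p" "p < y"
    using Rats_dense_in_real[of "y - e" y] e(1) by auto
  obtain q where q: "q \<in> \<rat>" "y < q" "q < y + e"
    using Rats_dense_in_real[of y "y + e"] e(1) by auto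
  have "{p<..<q} \<subseteq> A"
    using p q by (auto intro!: e(2) simp: dist_real_def)
  then show ?thesis using p q by auto
qed

lemma real_continuous_rc_lift:
  fixes f g :: "real set \<Rightarrow> 'a::frame"
  assumes T: "subframe T" and f: "real_continuous T f" and g: "real_continuous T g"
    and cont: "continuous_on UNIV (\<lambda>(y, z). d y z)"
  shows "real_continuous T (rc_lift d f g)"
proof -
  have hom: "frame_hom f" "frame_hom g" using f g by (auto simp: real_continuous_def)
  have "rc_lift d f g U \<in> T" if U: "open U" for U
  proof -
    let ?B = "{inf (f {p<..<q}) (g {r<..<s}) |p q r s. p \<in> \<rat> \<and> q \<in> \<rat> \<and> r \<in> \<rat> \<and> s \<in> \<rat> \<and>
      {d y z |y z. y \<in> {p<..<q} \<and> z \<in> {r<..<s}} \<subseteq> U}"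
    have "rc_lift d f g U = Sup ?B"
    proof (rule order.antisym)
      show "Sup ?B \<le> rc_lift d f g U"
        unfolding rc_lift_def by (intro Sup_subset_mono) blast
      show "rc_lift d f g U \<le> Sup ?B"
        unfolding rc_lift_points[OF hom]
      proof (rule SUP_least, clarify)
        fix y z assume yz: "d y z \<in> U"
        have "open ((\<lambda>(y, z). d y z) -` U)"
          using cont U by (simp add: continuous_on_open_vimage)
        moreover have "(y, z) \<in> (\<lambda>(y, z). d y z) -` U" using yz by simp
        ultimately obtain A B where AB: "open A" "open B" "y \<in> A" "z \<in> B"
          "A \<times> B \<subseteq> (\<lambda>(y, z). d y z) -` U"
          by (metis mem_Sigma_iff open_prod_elim)
        obtain p q where pq: "p \<in> \<rat>" "q \<in> \<rat>" "y \<in> {p<..<q}" "{p<..<q} \<subseteq> A"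
          using rational_interval_in_open[OF AB(1,3)] by blast
        obtain r s where rs: "r \<in> \<rat>" "s \<in> \<rat>" "z \<in> {r<..<s}" "{r<..<s} \<subseteq> B"
          using rational_interval_in_open[OF AB(2,4)] by blast
        have "inf (f {y}) (g {z}) \<le> inf (f {p<..<q}) (g {r<..<s})"
          using pq(3) rs(3)
          by (intro inf_mono; simp add: hom frame_hom_mono)
        also have "\<dots> \<le> Sup ?B"
        proof (rule Sup_upper)
          have "{d y z |y z. y \<in> {p<..<q} \<and> z \<in> {r<..<s}} \<subseteq> U"
          proof clarify
            fix y z assume "y \<in> {p<..<q}" "z \<in> {r<..<s}"
            then have "(y, z) \<in> (\<lambda>(y, z). d y z) -` U"
              using pq(4) rs(4) AB(5) by (meson SigmaI subsetD)
            then show "d y z \<in> U" by simp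
          qed
          then show "inf (f {p<..<q}) (g {r<..<s}) \<in> ?B"
            using pq(1,2) rs(1,2) by (intro CollectI exI conjI) (rule refl)
        qed
        finally show "inf (f {y}) (g {z}) \<le> Sup ?B" .
      qed
    qed
    moreover have "?B \<subseteq> T"
      using f g T by (auto simp: real_continuous_def subframe_def)
    ultimately show ?thesis using T by (simp add: subframe_def)
  qed
  then show ?thesis
    using frame_hom_rc_lift[OF hom] by (simp add: real_continuous_def)
qed

lemma frame_hom_rc_const: "frame_hom (rc_const r :: real set \<Rightarrow> 'a::frame)"
proof -
  have "rc_const r (Sup S) = (Sup (rc_const r ` S) :: 'a)" for S
  proof (cases "r \<in> \<Union>S")
    case True
    then obtain X where "X \<in> S" "r \<in> X" by blast
    then have "(top::'a) \<le> Sup (rc_const r ` S)"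
      by (intro SUP_upper2[of X]) (auto simp: rc_const_def)
    then show ?thesis using True by (auto simp: rc_const_def top_unique)
  next
    case False
    then have "Sup (rc_const r ` S) \<le> (bot::'a)"
      by (intro SUP_least) (auto simp: rc_const_def)
    then show ?thesis using False by (auto simp: rc_const_def bot_unique)
  qed
  then show ?thesis by (auto simp: frame_hom_def rc_const_def)
qed

lemma real_continuous_rc_const:
  assumes "subframe T"
  shows "real_continuous T (rc_const r)"
proof -
  have "bot \<in> T" using assms unfolding subframe_def by (metis Sup_empty empty_subsetI)
  then show ?thesis
    using assms frame_hom_rc_const by (auto simp: real_continuous_def rc_const_def subframe_def)
qed

lemma real_continuous_uminus:
  fixes f :: "real set \<Rightarrow> 'a::frame"
  assumes "real_continuous T f"
  shows "real_continuous T (\<lambda>X. f (uminus ` X))"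
proof -
  have f: "frame_hom f" using assms by (simp add: real_continuous_def)
  have "frame_hom (\<lambda>X. f (uminus ` X))"
    unfolding frame_hom_def
  proof (intro conjI allI)
    have "range (uminus :: real \<Rightarrow> real) = UNIV" by (rule surj_uminus)
    then show "f (uminus ` top) = top" using frame_homD(1)[OF f] by simp
    show "f (uminus ` inf X Y) = inf (f (uminus ` X)) (f (uminus ` Y))" for X Y
      using frame_homD(2)[OF f, of "uminus ` X" "uminus ` Y"] by (simp add: image_Int)
    show "f (uminus ` Sup S) = (SUP X\<in>S. f (uminus ` X))" for S
      using frame_homD(3)[OF f, of "(\<lambda>X. uminus ` X) ` S"] by (simp add: image_image image_Union)
  qed
  then show ?thesis
    using assms by (simp add: real_continuous_def)
qed

theorem cring_rc_ring:
  assumes "topoframe T"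
  shows "cring (rc_ring T)"
proof -
  have T: "subframe T" using assms by (simp add: topoframe_def)
  have hom: "frame_hom f" if "real_continuous T f" for f
    using that by (simp add: real_continuous_def)
  have add: "real_continuous T (rc_lift (+) f g)"
    and mult: "real_continuous T (rc_lift (*) f g)"
    if "real_continuous T f" "real_continuous T g" for f g
    using that by (auto intro!: real_continuous_rc_lift T continuous_intros simp: split_beta)
  note homs = hom frame_hom_rc_lift frame_hom_rc_const
  have lift: "a \<le> rc_lift d f g {d x y}" if "a \<le> f {x}" "a \<le> g {y}"
    for f g :: "real set \<Rightarrow> 'a" and a d x y
    using rc_lift_upper[of d x y "{d x y}" f g] that by (meson le_inf_iff order_trans singletonI)
  have const1: "a \<le> rc_const r {r}" for a :: 'a and r by (simp add: rc_const_def)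
  have eqI: "F = G"
    if "real_continuous T f" "real_continuous T g" "real_continuous T h" "frame_hom F" "frame_hom G"
      "\<And>x y z a. a \<le> f {x} \<Longrightarrow> a \<le> g {y} \<Longrightarrow> a \<le> h {z} \<Longrightarrow> \<exists>r. a \<le> F {r} \<and> a \<le> G {r}"
    for f g h F G :: "real set \<Rightarrow> 'a"
  proof (rule frame_hom_eqI[OF hom[OF that(1)] hom[OF that(2)] hom[OF that(3)] that(4,5)])
    fix x y z
    have "inf (inf (f {x}) (g {y})) (h {z}) \<le> f {x}" "inf (inf (f {x}) (g {y})) (h {z}) \<le> g {y}"
      "inf (inf (f {x}) (g {y})) (h {z}) \<le> h {z}"
      by (simp_all add: le_infI1)
    from that(6)[OF this] show "\<exists>r. inf (inf (f {x}) (g {y})) (h {z}) \<le> inf (F {r}) (G {r})"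
      by simp
  qed
  have assoc: "rc_lift d (rc_lift d f g) h = rc_lift d f (rc_lift d g h)"
    if "real_continuous T f" "real_continuous T g" "real_continuous T h"
      "\<And>x y z. d (d x y) z = d x (d y z)" for f g h :: "real set \<Rightarrow> 'a" and d
  proof (rule eqI[OF that(1-3)])
    fix x y z a assume a: "a \<le> f {x}" "a \<le> g {y}" "a \<le> h {z}"
    show "\<exists>r. a \<le> rc_lift d (rc_lift d f g) h {r} \<and> a \<le> rc_lift d f (rc_lift d g h) {r}"
      using lift[of a "rc_lift d f g" "d x y" h z d, OF lift[of a f x g y d, OF a(1,2)] a(3)]
        lift[of a f x "rc_lift d g h" "d y z" d, OF a(1) lift[of a g y h z d, OF a(2,3)]]
      by (auto simp: that(4))
  qed (simp_all add: homs that(1-3))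
  have comm: "rc_lift d f g = rc_lift d g f"
    if "real_continuous T f" "real_continuous T g" "\<And>x y. d x y = d y x"
    for f g :: "real set \<Rightarrow> 'a" and d
  proof (rule eqI[OF that(1,2,2)])
    fix x y z a assume a: "a \<le> f {x}" "a \<le> g {y}"
    show "\<exists>r. a \<le> rc_lift d f g {r} \<and> a \<le> rc_lift d g f {r}"
      using lift[of a f x g y d, OF a] lift[of a g y f x d, OF a(2,1)] by (auto simp: that(3))
  qed (simp_all add: homs that(1,2))
  have unit: "rc_lift d (rc_const r) f = f"
    if "real_continuous T f" "\<And>x. d r x = x" for f :: "real set \<Rightarrow> 'a" and d r
  proof (rule eqI[OF that(1,1,1)])
    fix x y z a assume a: "a \<le> f {x}"
    show "\<exists>s. a \<le> rc_lift d (rc_const r) f {s} \<and> a \<le> f {s}"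
      using lift[of a "rc_const r" r f x d, OF const1 a] a by (auto simp: that(2))
  qed (simp_all add: homs that(1))
  have neg: "rc_lift (+) (\<lambda>X. f (uminus ` X)) f = rc_const 0"
    if "real_continuous T f" for f :: "real set \<Rightarrow> 'a"
  proof (rule eqI[OF that that that])
    fix x y z a assume a: "a \<le> f {x}"
    show "\<exists>s. a \<le> rc_lift (+) (\<lambda>X. f (uminus ` X)) f {s} \<and> a \<le> rc_const 0 {s}"
      using lift[of a "\<lambda>X. f (uminus ` X)" "- x" f x "(+)"] a const1[of a 0] by auto
  qed (simp_all add: homs that real_continuous_uminus)
  have distr: "rc_lift (*) (rc_lift (+) f g) h = rc_lift (+) (rc_lift (*) f h) (rc_lift (*) g h)"
    if "real_continuous T f" "real_continuous T g" "real_continuous T h"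
    for f g h :: "real set \<Rightarrow> 'a"
  proof (rule eqI[OF that])
    fix x y z a assume a: "a \<le> f {x}" "a \<le> g {y}" "a \<le> h {z}"
    show "\<exists>r. a \<le> rc_lift (*) (rc_lift (+) f g) h {r} \<and>
        a \<le> rc_lift (+) (rc_lift (*) f h) (rc_lift (*) g h) {r}"
      using lift[of a "rc_lift (+) f g" "x + y" h z "(*)", OF lift[of a f x g y "(+)", OF a(1,2)] a(3)]
        lift[of a "rc_lift (*) f h" "x * z" "rc_lift (*) g h" "y * z" "(+)",
          OF lift[of a f x h z "(*)", OF a(1,3)] lift[of a g y h z "(*)", OF a(2,3)]]
      by (auto simp: distrib_right)
  qed (simp_all add: homs that)
  have simps: "carrier (rc_ring T) = {f. real_continuous T f}" "mult (rc_ring T) = rc_lift (*)"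
    "one (rc_ring T) = rc_const 1" "zero (rc_ring T) = rc_const 0" "add (rc_ring T) = rc_lift (+)"
    by (simp_all add: rc_ring_def)
  have comm_add: "rc_lift (+) f g = rc_lift (+) g f"
    and comm_mult: "rc_lift (*) f g = rc_lift (*) g f"
    if "real_continuous T f" "real_continuous T g" for f g
    using that by (rule comm; simp)+
  show ?thesis
  proof (rule cringI)
    show "abelian_group (rc_ring T)"
    proof (rule abelian_groupI, unfold simps mem_Collect_eq)
      show "\<exists>g\<in>{f. real_continuous T f}. rc_lift (+) g f = rc_const 0"
        if "real_continuous T f" for f
        using neg[OF that] real_continuous_uminus[OF that] by blast
    qed (simp_all add: add assoc unit comm_add real_continuous_rc_const T)
    show "comm_monoid (rc_ring T)"
      by (rule comm_monoidI, unfold simps mem_Collect_eq)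
         (simp_all add: mult assoc unit comm_mult real_continuous_rc_const T)
  qed (unfold simps mem_Collect_eq, rule distr)
qed

end

theory Submission
  imports Defs
begin

text \<open>
  A real-continuous function is a partition of \<open>\<top>\<close> into pieces \<open>f {x}\<close>, and \<open>a \<le> f {x}\<close> reads
  \<open>f\<close> has the value \<open>x\<close> on \<open>a\<close>. Ring identities in \<open>\<R>L\<^sub>\<tau>\<close> can therefore be checked value by value
  on the pieces of a common refinement, as if the elements were functions on a space.

  The ring is reduced. In a reduced commutative ring the map \<open>a x\<^sup>2 \<mapsto> a x\<close> on the ideal generated
  by \<open>x\<^sup>2\<close> is well defined. If it extends to the whole ring, it is multiplication by some \<open>y\<close>, and
  evaluation at \<open>x\<^sup>2\<close> gives \<open>x = x\<^sup>2 y\<close>. So self-injectivity implies regularity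
  (\<open>reduced_selfinjective_imp_regular\<close>).

  Conversely, let the ring be regular, and let \<open>h\<close> be a homomorphism on the ideal generated by
  \<open>s\<^sub>0, s\<^sub>1, \<dots>\<close>. Write \<open>s\<^sub>n = s\<^sub>n\<^sup>2 t\<^sub>n\<close>, so that \<open>e\<^sub>n = s\<^sub>n t\<^sub>n\<close> is an idempotent, equal to \<open>1\<close> where
  \<open>s\<^sub>n\<close> is nonzero and to \<open>0\<close> elsewhere; let \<open>E\<^sub>n\<close> be the part where \<open>e\<^sub>n\<close> is \<open>1\<close>. The functions
  \<open>h e\<^sub>n\<close> and \<open>h e\<^sub>m\<close> agree on \<open>E\<^sub>n \<sqinter> E\<^sub>m\<close> since \<open>e\<^sub>m (h e\<^sub>n) = h (e\<^sub>m e\<^sub>n) = e\<^sub>n (h e\<^sub>m)\<close>. They are glued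
  along the \<open>E\<^sub>n\<close>, with the value \<open>0\<close> on the complement \<open>C\<close> of \<open>\<Squnion>E\<^sub>n\<close>, to a function \<open>g\<close>
  (\<open>glue_real_continuous\<close>). Then \<open>h s\<^sub>n = s\<^sub>n (h e\<^sub>n) = s\<^sub>n g\<close>, so multiplication by \<open>g\<close> extends \<open>h\<close>.

  An open interval around \<open>0\<close> is sent by \<open>g\<close> to an element that contains \<open>C\<close>, so real-continuity of
  \<open>g\<close> calls for \<open>C\<close> in \<open>\<tau>\<close>. This is where regularity is used a second time
  (\<open>countable_join_complement\<close>). Make the \<open>E\<^sub>n\<close> disjoint and let \<open>f\<close> have the value \<open>1/(n+1)\<close> on the \<open>n\<close>-th piece and \<open>0\<close> on \<open>C\<close>. Because these values tend to \<open>0\<close>, \<open>f\<close> is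
  real-continuous even before \<open>C\<close> is known to be in \<open>\<tau>\<close>. But in a regular ring \<open>f\<close> vanishes exactly
  where some idempotent does, and the zero part of an idempotent is its value on an open interval.
\<close>

section \<open>Values of real-continuous functions\<close>

lemma inf_sup_frame: "inf a (sup x y) = sup (inf a x) (inf (a::'a::frame) y)"
  using inf_Sup_distrib[of a "{x, y}"] by simp

lemma le_by_cover:
  fixes a b :: "'a::frame"
  assumes "(SUP i\<in>I. u i) = top" "\<And>i. i \<in> I \<Longrightarrow> inf a (u i) \<le> b"
  shows "a \<le> b"
proof -
  have "inf a (SUP i\<in>I. u i) \<le> b"
    unfolding inf_SUP_frame using assms(2) by (rule SUP_least)
  then show ?thesis using assms(1) by simp
qed

lemma le_by_cases:
  fixes a b :: "'a::frame"
  assumes "sup x y = top" "inf a x \<le> b" "inf a y \<le> b"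
  shows "a \<le> b"
  using inf_sup_frame[of a x y] assms by (metis inf_top_right sup_least)

lemma rc_lift_value:
  fixes f g :: "real set \<Rightarrow> 'a::frame"
  assumes "a \<le> f {x}" "a \<le> g {y}"
  shows "a \<le> rc_lift d f g {d x y}"
  using rc_lift_upper[of d x y "{d x y}" f g] assms by (meson le_inf_iff order_trans singletonI)

lemma value_unique:
  fixes f :: "real set \<Rightarrow> 'a::frame"
  assumes "frame_hom f" "a \<le> f {x}" "a \<le> f {y}" "x \<noteq> y"
  shows "a = bot"
proof -
  have "a \<le> inf (f {x}) (f {y})" using assms(2,3) by simp
  then show ?thesis
    using frame_hom_disjoint[OF assms(1), of "{x}" "{y}"] assms(4) by (simp add: bot_unique)
qed

text \<open>
  Equality is checked on the pieces where three given functions have constant values. The value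
  \<open>r\<close> must be found only on nonempty pieces, which makes contradictory values harmless.
\<close>

lemma frame_hom_eq_by_values:
  fixes f g h F G :: "real set \<Rightarrow> 'a::frame"
  assumes "frame_hom f" "frame_hom g" "frame_hom h" "frame_hom F" "frame_hom G"
    and "\<And>x y z a. a \<noteq> bot \<Longrightarrow> a \<le> f {x} \<Longrightarrow> a \<le> g {y} \<Longrightarrow> a \<le> h {z} \<Longrightarrow>
      \<exists>r. a \<le> F {r} \<and> a \<le> G {r}"
  shows "F = G"
proof (rule frame_hom_eqI[OF assms(1-5)])
  fix x y z
  let ?a = "inf (inf (f {x}) (g {y})) (h {z})"
  have "?a \<le> f {x}" "?a \<le> g {y}" "?a \<le> h {z}" by (simp_all add: le_infI1)
  then show "\<exists>r. ?a \<le> inf (F {r}) (G {r})"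
    using assms(6)[of ?a x y z] by (cases "?a = bot") auto
qed

lemma real_continuous_frame_hom: "real_continuous T f \<Longrightarrow> frame_hom f"
  by (simp add: real_continuous_def)

lemma rc_ring_simps:
  "carrier (rc_ring T) = {f. real_continuous T f}" "mult (rc_ring T) = rc_lift (*)"
  "one (rc_ring T) = rc_const 1" "zero (rc_ring T) = rc_const 0" "add (rc_ring T) = rc_lift (+)"
  by (simp_all add: rc_ring_def)

lemma rc_ring_reduced:
  fixes f :: "real set \<Rightarrow> 'a::frame"
  assumes "frame_hom f" "rc_lift (*) f f = rc_const 0"
  shows "f = rc_const 0"
proof (rule frame_hom_eq_by_values[OF assms(1,1,1,1) frame_hom_rc_const])
  fix x a assume a: "a \<noteq> bot" "a \<le> f {x}"
  have "a \<le> rc_const 0 {x * x}"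
    using rc_lift_value[of a f x f x "(*)"] a(2) assms(2) by simp
  then have "x = 0"
    using a(1) by (auto simp: rc_const_def bot_unique split: if_splits)
  then show "\<exists>r. a \<le> f {r} \<and> a \<le> rc_const 0 {r}"
    using a(2) by (auto simp: rc_const_def)
qed

text \<open>
  The pieces \<open>d i\<close> may overlap as long as they carry the same value there, so that locally defined
  functions need not be made disjoint before they are glued.
\<close>

lemma frame_hom_glue:
  fixes d :: "'i \<Rightarrow> 'a::frame" and v :: "'i \<Rightarrow> real"
  assumes cover: "(SUP i. d i) = top"
    and compatible: "\<And>i j. v i \<noteq> v j \<Longrightarrow> inf (d i) (d j) = bot"
  shows "frame_hom (\<lambda>X. SUP i\<in>{i. v i \<in> X}. d i)" (is "frame_hom ?F")
proof -
  have upper: "d i \<le> ?F X" if "v i \<in> X" for i X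
    using that by (intro SUP_upper) simp
  have "inf (?F X) (?F Y) \<le> ?F (inf X Y)" for X Y
  proof -
    have "inf (d i) (d j) \<le> ?F (inf X Y)" if "v i \<in> X" "v j \<in> Y" for i j
    proof (cases "v i = v j")
      case True
      then show ?thesis using that upper[of i "inf X Y"] by (simp add: le_infI1)
    qed (simp add: compatible)
    then show ?thesis
      by (auto simp: SUP_inf_frame inf_SUP_frame intro!: SUP_least)
  qed
  moreover have "?F (inf X Y) \<le> inf (?F X) (?F Y)" for X Y
    by (intro le_infI SUP_subset_mono) auto
  ultimately have inf: "?F (inf X Y) = inf (?F X) (?F Y)" for X Y
    by (rule order.antisym[rotated])
  have "?F (Sup S) = Sup (?F ` S)" for S
  proof (rule order.antisym)
    show "?F (Sup S) \<le> Sup (?F ` S)"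
      by (auto intro!: SUP_least intro: SUP_upper2 upper)
    show "Sup (?F ` S) \<le> ?F (Sup S)"
      by (intro SUP_least upper) auto
  qed
  then show ?thesis
    unfolding frame_hom_def using inf cover by simp
qed

section \<open>Self-injectivity implies regularity\<close>

lemma (in cring) reduced_selfinjective_imp_regular:
  assumes reduced: "\<And>x. x \<in> carrier R \<Longrightarrow> x \<otimes> x = \<zero> \<Longrightarrow> x = \<zero>"
    and selfinj: "aleph0_selfinjective R"
  shows "regular_cring R"
proof
  fix x assume x: "x \<in> carrier R"
  let ?q = "x \<otimes> x"
  \<comment> \<open>This makes \<open>a x\<^sup>2 \<mapsto> a x\<close> well defined: if \<open>c x\<^sup>2 = 0\<close>, then \<open>(c x)\<^sup>2 = 0\<close>.\<close>
  have cancel: "a \<otimes> x = b \<otimes> x"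
    if ab: "a \<in> carrier R" "b \<in> carrier R" "a \<otimes> ?q = b \<otimes> ?q" for a b
  proof -
    let ?c = "a \<ominus> b"
    have c: "?c \<in> carrier R" using ab by simp
    have "?c \<otimes> ?q = \<zero>"
      using ab x by (simp add: minus_eq l_distr l_minus r_neg)
    then have "(?c \<otimes> x) \<otimes> (?c \<otimes> x) = \<zero>"
      using c x m_assoc[of ?c x "?c \<otimes> x"] m_lcomm[of x ?c x] by simp
    then have "?c \<otimes> x = \<zero>" using reduced[OF m_closed[OF c x]] by blast
    then have "a \<otimes> x \<oplus> \<ominus> (b \<otimes> x) = \<zero>"
      using ab x by (simp add: minus_eq l_distr l_minus)
    from minus_equality[OF this] show ?thesis using ab x by simp
  qed
  define h where "h z = (SOME a. a \<in> carrier R \<and> z = a \<otimes> ?q) \<otimes> x" for z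
  have h: "h (a \<otimes> ?q) = a \<otimes> x" if a: "a \<in> carrier R" for a
  proof -
    let ?P = "\<lambda>b. b \<in> carrier R \<and> a \<otimes> ?q = b \<otimes> ?q"
    have "?P (Eps ?P)" by (rule someI[of ?P a]) (simp add: a)
    then show ?thesis unfolding h_def using cancel a by metis
  qed
  have I: "Idl {?q} = {a \<otimes> ?q |a. a \<in> carrier R}"
    using x cgenideal_eq_genideal[of ?q] by (simp add: cgenideal_def)
  have "countably_generated_ideal R (Idl {?q})"
    unfolding countably_generated_ideal_def using x by (intro exI[of _ "{?q}"]) auto
  moreover have "ideal_hom R (Idl {?q}) h"
    unfolding ideal_hom_def I
  proof (intro conjI ballI)
    fix y z assume "y \<in> {a \<otimes> ?q |a. a \<in> carrier R}" "z \<in> {a \<otimes> ?q |a. a \<in> carrier R}"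
    then obtain a b where ab: "a \<in> carrier R" "b \<in> carrier R" "y = a \<otimes> ?q" "z = b \<otimes> ?q" by blast
    then show "h (y \<oplus> z) = h y \<oplus> h z"
      using x h[of "a \<oplus> b"] by (simp add: h l_distr)
  next
    fix c y assume "c \<in> carrier R" "y \<in> {a \<otimes> ?q |a. a \<in> carrier R}"
    then obtain a where "c \<in> carrier R" "a \<in> carrier R" "y = a \<otimes> ?q" by blast
    then show "h (c \<otimes> y) = c \<otimes> h y"
      using x h[of "c \<otimes> a"] by (simp add: h m_assoc)
  qed (use x h in auto)
  ultimately obtain k where k: "ideal_hom R (carrier R) k" "\<forall>z\<in>Idl {?q}. k z = h z"
    using aleph0_selfinjective.extend[OF selfinj] by blast
  have k1: "k \<one> \<in> carrier R" using k(1) by (auto simp: ideal_hom_def)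
  have "x = h ?q" using h[of \<one>] x by simp
  also have "\<dots> = k (?q \<otimes> \<one>)" using k(2) x by (simp add: genideal_self')
  also have "\<dots> = ?q \<otimes> k \<one>"
    using k(1) x unfolding ideal_hom_def by (meson m_closed one_closed)
  finally show "\<exists>y\<in>carrier R. x = x [^] (2::nat) \<otimes> y"
    using k1 x by (auto simp: numeral_2_eq_2)
qed

section \<open>Complements in regular rings\<close>

text \<open>
  A value \<open>x\<close> of an idempotent satisfies \<open>x\<^sup>2 = x\<close>. Hence an open interval that contains only one of
  \<open>0\<close> and \<open>1\<close> is sent to the piece of that value, which puts the piece into \<open>\<tau>\<close>.
\<close>

lemma idempotent_values:
  fixes e :: "real set \<Rightarrow> 'a::frame"
  assumes T: "real_continuous T e" and idem: "rc_lift (*) e e = e"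
  shows "e {0} \<in> T" "e {1} \<in> T" "inf (e {1}) (e {0}) = bot" "sup (e {1}) (e {0}) = top"
proof -
  note hom = real_continuous_frame_hom[OF T]
  have other: "e {x} = bot" if "x \<noteq> 0" "x \<noteq> 1" for x
  proof (rule value_unique[OF hom order_refl])
    show "e {x} \<le> e {x * x}"
      using rc_lift_value[of "e {x}" e x e x "(*)"] idem by simp
    show "x \<noteq> x * x" using that by simp
  qed
  have on_01: "e X = e (X \<inter> {0, 1})" for X
  proof (rule order.antisym)
    show "e X \<le> e (X \<inter> {0, 1})"
      unfolding frame_hom_points[OF hom, of X]
    proof (rule SUP_least)
      fix x assume "x \<in> X"
      then show "e {x} \<le> e (X \<inter> {0, 1})"
        by (cases "x = 0 \<or> x = 1") (auto simp: other intro!: frame_hom_mono[OF hom])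
    qed
  qed (simp add: frame_hom_mono[OF hom])
  have "{- 1<..<1} \<inter> {0, 1} = {0::real}" "{0<..<2} \<inter> {0, 1} = {1::real}" by auto
  then have "e {0} = e {- 1<..<1}" "e {1} = e {0<..<2}"
    using on_01[of "{- 1<..<1}"] on_01[of "{0<..<2}"] by simp_all
  moreover have "e {- 1<..<1} \<in> T" "e {0<..<2} \<in> T"
    using T by (auto simp: real_continuous_def)
  ultimately show "e {0} \<in> T" "e {1} \<in> T" by simp_all
  show "inf (e {1}) (e {0}) = bot" by (simp add: frame_hom_disjoint[OF hom])
  have "sup (e {1}) (e {0}) = e {1, 0}"
    using frame_homD(3)[OF hom, of "{{1}, {0}}"] by (simp add: insert_commute)
  then show "sup (e {1}) (e {0}) = top"
    using on_01[of UNIV] frame_homD(1)[OF hom] by (simp add: insert_commute)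
qed

text \<open>
  In \<open>f = f\<^sup>2 t\<close> the factor \<open>e = f t\<close> is forced to be \<open>1\<close> where \<open>f\<close> is nonzero, by \<open>f e = f\<close>, and it
  is \<open>0\<close> where \<open>f\<close> is: it is the characteristic function of the cozero part of \<open>f\<close>.
\<close>

lemma support_idempotent:
  fixes f t :: "real set \<Rightarrow> 'a::frame"
  assumes T: "topoframe T" and f: "real_continuous T f" and t: "real_continuous T t"
    and eq: "f = rc_lift (*) (rc_lift (*) f f) t"
  defines "e \<equiv> rc_lift (*) f t"
  shows "real_continuous T e" "rc_lift (*) e e = e" "rc_lift (*) f e = f" "e {0} = f {0}"
    "x \<noteq> 0 \<Longrightarrow> f {x} \<le> e {1}"
proof -
  interpret cring "rc_ring T" by (rule cring_rc_ring[OF T])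
  note clos = m_closed[unfolded rc_ring_simps, simplified]
  note assoc = m_assoc[unfolded rc_ring_simps, simplified]
  note comm = m_comm[unfolded rc_ring_simps, simplified]
  show e: "real_continuous T e" unfolding e_def by (rule clos[OF f t])
  show fe: "rc_lift (*) f e = f"
    using eq assoc[OF f f t] by (simp add: e_def)
  show "rc_lift (*) e e = e"
    using fe assoc[OF t f e] comm[OF f t] by (simp add: e_def)
  note homf = real_continuous_frame_hom[OF f] and home = real_continuous_frame_hom[OF e]
    and homt = real_continuous_frame_hom[OF t]
  show "e {0} = f {0}"
  proof (rule order.antisym)
    show "e {0} \<le> f {0}"
    proof (rule le_by_cover)
      show "(SUP x\<in>UNIV. f {x}) = top"
        using frame_hom_points[OF homf, of UNIV] frame_homD(1)[OF homf] by simp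
      show "inf (e {0}) (f {x}) \<le> f {0}" for x
        using rc_lift_value[of "inf (e {0}) (f {x})" f x e 0 "(*)"] fe by simp
    qed
    show "f {0} \<le> e {0}"
    proof (rule le_by_cover)
      show "(SUP y\<in>UNIV. t {y}) = top"
        using frame_hom_points[OF homt, of UNIV] frame_homD(1)[OF homt] by simp
      show "inf (f {0}) (t {y}) \<le> e {0}" for y
        using rc_lift_value[of "inf (f {0}) (t {y})" f 0 t y "(*)"] by (simp add: e_def)
    qed
  qed
  show "f {x} \<le> e {1}" if x: "x \<noteq> 0"
  proof (rule le_by_cover)
    show "(SUP y\<in>UNIV. e {y}) = top"
      using frame_hom_points[OF home, of UNIV] frame_homD(1)[OF home] by simp
    fix y
    let ?a = "inf (f {x}) (e {y})"
    have "?a \<le> f {x * y}"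
      using rc_lift_value[of ?a f x e y "(*)"] fe by simp
    then have "?a = bot" if "y \<noteq> 1"
      using that x by (intro value_unique[OF homf, of _ x "x * y"]) auto
    then show "?a \<le> e {1}" by (cases "y = 1") auto
  qed
qed

lemma regular_rc_ringD:
  assumes "regular_cring (rc_ring T)" "real_continuous T f"
  shows "\<exists>t. real_continuous T t \<and> f = rc_lift (*) (rc_lift (*) f f) t"
proof -
  interpret regular_cring "rc_ring T" by (rule assms(1))
  have f: "f \<in> carrier (rc_ring T)" using assms(2) by (simp add: rc_ring_simps)
  then have "f [^]\<^bsub>rc_ring T\<^esub> (2::nat) = rc_lift (*) f f"
    by (simp add: numeral_2_eq_2) (simp add: rc_ring_simps)
  then show ?thesis using regular[OF f] by (auto simp: rc_ring_simps)
qed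

lemma subframeD:
  assumes "subframe T"
  shows "top \<in> T" "bot \<in> T" "x \<in> T \<Longrightarrow> y \<in> T \<Longrightarrow> inf x y \<in> T" "x \<in> T \<Longrightarrow> y \<in> T \<Longrightarrow> sup x y \<in> T"
    "(\<And>i. i \<in> I \<Longrightarrow> u i \<in> T) \<Longrightarrow> (SUP i\<in>I. u i) \<in> T"
proof -
  have S: "Sup S \<in> T" if "S \<subseteq> T" for S using assms that by (simp add: subframe_def)
  show "top \<in> T" "x \<in> T \<Longrightarrow> y \<in> T \<Longrightarrow> inf x y \<in> T" using assms by (auto simp: subframe_def)
  show "bot \<in> T" using S[of "{}"] by simp
  show "x \<in> T \<Longrightarrow> y \<in> T \<Longrightarrow> sup x y \<in> T" using S[of "{x, y}"] by simp
  show "(\<And>i. i \<in> I \<Longrightarrow> u i \<in> T) \<Longrightarrow> (SUP i\<in>I. u i) \<in> T" by (rule S) auto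
qed

text \<open>
  The topoframe axioms give a complement of \<open>\<Squnion>E\<^sub>n\<close> in \<open>L\<close> only; regularity puts it into \<open>\<tau>\<close>, since
  it is the zero part of the function with value \<open>1/(n+1)\<close> on \<open>D n\<close>, the part of \<open>E n\<close> outside the
  earlier \<open>E m\<close>. That function is real-continuous because an open interval
  around \<open>0\<close> contains all but finitely many of the values, so it is sent to the join of some
  \<open>D n\<close> with the complement \<open>B N\<close> of a finite join.
\<close>

lemma countable_join_complement:
  fixes E E' :: "nat \<Rightarrow> 'a::frame"
  assumes T: "topoframe T" and reg: "regular_cring (rc_ring T)"
    and ET: "\<And>n. E n \<in> T" and E'T: "\<And>n. E' n \<in> T"
    and compl: "\<And>n. inf (E n) (E' n) = bot" "\<And>n. sup (E n) (E' n) = top"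
  shows "\<exists>C\<in>T. inf (SUP n. E n) C = bot \<and> sup (SUP n. E n) C = top"
proof -
  have sT: "subframe T" using T by (simp add: topoframe_def)
  have "(SUP n. E n) \<in> T" by (intro subframeD(5)[OF sT] ET)
  then obtain C where C: "inf (SUP n. E n) C = bot" "sup (SUP n. E n) C = top"
    using T by (auto simp: topoframe_def complemented_def)
  define B where "B n = (INF m\<in>{..<n}. E' m)" for n
  define D where "D n = inf (E n) (B n)" for n
  have B_Suc: "B (Suc n) = inf (E' n) (B n)" for n
    by (simp add: B_def lessThan_Suc)
  have BT: "B n \<in> T" for n
  proof (induction n)
    case 0
    then show ?case using subframeD(1)[OF sT] by (simp add: B_def)
  next
    case (Suc n)
    then show ?case using subframeD(3)[OF sT E'T] by (simp add: B_Suc)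
  qed
  have DT: "D n \<in> T" for n unfolding D_def by (intro subframeD(3)[OF sT] ET BT)
  have B_le: "B n \<le> E' m" if "m < n" for m n
    unfolding B_def using that by (intro INF_lower) simp
  have BD: "inf (B n) (D m) = bot" if "m < n" for m n
  proof -
    have "inf (B n) (D m) \<le> inf (E' m) (E m)"
      unfolding D_def using B_le[OF that] by (intro inf_mono) auto
    then show ?thesis using compl(1)[of m] by (simp add: inf_commute bot_unique)
  qed
  have CE: "inf C (E n) = bot" for n
  proof -
    have "inf C (E n) \<le> inf (SUP n. E n) C"
      by (metis SUP_upper UNIV_I inf.commute inf_mono order_refl)
    then show ?thesis using C(1) by (simp add: bot_unique)
  qed
  have C_le: "C \<le> E' n" for n
    using compl(2)[of n] by (rule le_by_cases) (simp_all add: CE)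
  have exhaust: "sup (B n) (SUP m\<in>{..<n}. D m) = top" for n
  proof (induction n)
    case 0
    then show ?case by (simp add: B_def)
  next
    case (Suc n)
    have "B n = sup (inf (B n) (E n)) (inf (B n) (E' n))"
      using compl(2)[of n] by (simp flip: inf_sup_frame)
    also have "\<dots> = sup (D n) (B (Suc n))" by (simp add: D_def B_Suc inf_commute)
    finally show ?case using Suc by (simp add: lessThan_Suc ac_simps)
  qed
  \<comment> \<open>After \<open>n + 1\<close> steps the rest \<open>B (Suc n)\<close> is disjoint from \<open>E n\<close>, so the pieces so far cover \<open>E n\<close>.\<close>
  have E_le: "E n \<le> (SUP m. D m)" for n
    using exhaust[of "Suc n"]
  proof (rule le_by_cases)
    have "inf (E n) (B (Suc n)) \<le> inf (E n) (E' n)" by (simp add: B_Suc le_infI2)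
    then show "inf (E n) (B (Suc n)) \<le> (SUP m. D m)" by (simp add: compl(1) bot_unique)
    show "inf (E n) (SUP m\<in>{..<Suc n}. D m) \<le> (SUP m. D m)"
      by (intro le_infI2 SUP_subset_mono) auto
  qed
  \<comment> \<open>The index \<open>None\<close> stands for the piece \<open>C\<close>, where the function is \<open>0\<close>.\<close>
  define d where "d i = (case i of None \<Rightarrow> C | Some n \<Rightarrow> D n)" for i
  define v :: "nat option \<Rightarrow> real" where "v i = (case i of None \<Rightarrow> 0 | Some n \<Rightarrow> 1 / (real n + 1))" for i
  define F where "F X = (SUP i\<in>{i. v i \<in> X}. d i)" for X
  have d_simps: "d None = C" "d (Some n) = D n" for n by (simp_all add: d_def)
  have v_simps: "v None = 0" "v (Some n) = 1 / (real n + 1)" for n by (simp_all add: v_def)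
  have cover: "(SUP i. d i) = top"
  proof -
    have "(SUP n. E n) \<le> (SUP i. d i)"
    proof (rule SUP_least)
      fix n
      have "(SUP m. D m) \<le> (SUP i. d i)"
        by (intro SUP_least SUP_upper2[of "Some _"]) (auto simp: d_simps)
      then show "E n \<le> (SUP i. d i)" using E_le by (rule order_trans[rotated])
    qed
    moreover have "C \<le> (SUP i. d i)"
      by (intro SUP_upper2[of None]) (auto simp: d_simps)
    ultimately show ?thesis using C(2) by (metis sup_least top_unique)
  qed
  have CD: "inf C (D n) = bot" for n
    using CE[of n] unfolding D_def by (metis inf_assoc inf_bot_left)
  have DD: "inf (D m) (D n) = bot" if "m \<noteq> n" for m n
  proof -
    have "inf (D m) (D n) = bot" if "m < n" for m n
      using BD[OF that] unfolding D_def[of n] by (metis inf_assoc inf_commute inf_bot_left)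
    then show ?thesis using that by (metis inf_commute linorder_neqE_nat)
  qed
  have homF: "frame_hom F"
    unfolding F_def
  proof (rule frame_hom_glue[OF cover])
    fix i j assume "v i \<noteq> v j"
    then show "inf (d i) (d j) = bot"
      using CD DD by (cases i; cases j) (auto simp: d_simps v_simps inf_commute[of _ C])
  qed
  have F_upper: "d i \<le> F X" if "v i \<in> X" for i X
    unfolding F_def using that by (intro SUP_upper) simp
  have "F {p<..<q} \<in> T" for p q
  proof (cases "0 \<in> {p<..<q}")
    case False
    have "d i \<in> T" if "v i \<in> {p<..<q}" for i
      using that False DT by (cases i) (auto simp: d_simps v_simps)
    then show ?thesis
      unfolding F_def by (intro subframeD(5)[OF sT]) simp
  next
    case True
    then obtain N :: nat where N: "inverse (real (Suc N)) < q"
      using reals_Archimedean[of q] by auto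
    have tail: "v (Some n) \<in> {p<..<q}" if "n \<ge> N" for n
    proof -
      have "1 / (real n + 1) \<le> inverse (real (Suc N))"
        using that by (simp add: field_simps)
      moreover have "0 < 1 / (real n + 1)" by simp
      ultimately show ?thesis using N True by (auto simp: v_simps intro: less_trans)
    qed
    let ?S = "SUP n\<in>{n. v (Some n) \<in> {p<..<q}}. D n"
    have "F {p<..<q} = sup (B N) ?S"
    proof (rule order.antisym)
      show "F {p<..<q} \<le> sup (B N) ?S"
        unfolding F_def
      proof (rule SUP_least)
        fix i assume i: "i \<in> {i. v i \<in> {p<..<q}}"
        show "d i \<le> sup (B N) ?S"
        proof (cases i)
          case None
          have "C \<le> B N" unfolding B_def by (intro INF_greatest C_le)
          then show ?thesis using None by (simp add: d_simps le_supI1)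
        next
          case (Some n)
          then have "D n \<le> ?S" using i by (intro SUP_upper) simp
          then show ?thesis using Some by (simp add: d_simps le_supI2)
        qed
      qed
      have "B N \<le> F {p<..<q}"
      proof (rule le_by_cover[OF cover])
        fix i
        show "inf (B N) (d i) \<le> F {p<..<q}"
        proof (cases "v i \<in> {p<..<q}")
          case True
          then show ?thesis by (intro le_infI2 F_upper)
        next
          case False
          then obtain n where n: "i = Some n"
            using \<open>0 \<in> {p<..<q}\<close> by (cases i) (auto simp: v_simps)
          then have "n < N" using False tail by (meson not_le)
          then show ?thesis using BD n by (simp add: d_simps)
        qed
      qed
      moreover have "D n \<le> F {p<..<q}" if "v (Some n) \<in> {p<..<q}" for n
        using F_upper[OF that] by (simp add: d_simps)
      ultimately show "sup (B N) ?S \<le> F {p<..<q}"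
        by (intro sup_least SUP_least) auto
    qed
    moreover have "?S \<in> T" by (intro subframeD(5)[OF sT] DT)
    ultimately show ?thesis using subframeD(4)[OF sT BT] by simp
  qed
  then have F: "real_continuous T F" using homF by (simp add: real_continuous_def)
  have "{i. v i \<in> {0}} = {None}"
  proof -
    have "v (Some n) \<noteq> 0" for n by (simp add: v_simps)
    then have "v i = 0 \<longleftrightarrow> i = None" for i by (cases i) (simp_all add: v_simps)
    then show ?thesis by auto
  qed
  then have "F {0} = C" by (simp add: F_def d_simps)
  moreover obtain t where t: "real_continuous T t" "F = rc_lift (*) (rc_lift (*) F F) t"
    using regular_rc_ringD[OF reg F] by blast
  note e = support_idempotent[OF T F t]
  have "F {0} \<in> T" using idempotent_values(1)[OF e(1,2)] e(4) by simp
  ultimately show ?thesis using C by auto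
qed

section \<open>Regularity implies self-injectivity\<close>

text \<open>
  An interval is sent by the glued function to the join of the \<open>E n \<sqinter> h n (p, q)\<close>, together with \<open>C\<close>
  if the interval contains \<open>0\<close>; this is in \<open>\<tau>\<close> because \<open>E n\<close> and \<open>C\<close> are. Agreement of \<open>h m\<close> and \<open>h n\<close> on
  \<open>E m \<sqinter> E n\<close> is expressed by saying that they cannot have different values there.
\<close>

lemma glue_real_continuous:
  fixes E :: "nat \<Rightarrow> 'a::frame" and h :: "nat \<Rightarrow> real set \<Rightarrow> 'a"
  assumes T: "subframe T" and ET: "\<And>n. E n \<in> T" and CT: "C \<in> T"
    and compl: "inf (SUP n. E n) C = bot" "sup (SUP n. E n) C = top"
    and h: "\<And>n. real_continuous T (h n)"
    and agree: "\<And>m n x y. x \<noteq> y \<Longrightarrow> inf (inf (E m) (h m {x})) (inf (E n) (h n {y})) = bot"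
  shows "\<exists>g. real_continuous T g \<and> (\<forall>n x. inf (E n) (h n {x}) \<le> g {x})"
proof -
  define d where "d i = (case i of None \<Rightarrow> C | Some (n, x) \<Rightarrow> inf (E n) (h n {x}))" for i
  define v :: "(nat \<times> real) option \<Rightarrow> real" where "v i = (case i of None \<Rightarrow> 0 | Some (n, x) \<Rightarrow> x)" for i
  define G where "G X = (SUP i\<in>{i. v i \<in> X}. d i)" for X
  have d_simps: "d None = C" "d (Some (n, x)) = inf (E n) (h n {x})" for n x
    by (simp_all add: d_def)
  have v_simps: "v None = 0" "v (Some (n, x)) = x" for n x by (simp_all add: v_def)
  have points: "inf (E n) (h n X) = (SUP x\<in>X. inf (E n) (h n {x}))" for n X
    using frame_hom_points[OF real_continuous_frame_hom[OF h], of n X] by (simp add: inf_SUP_frame)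
  have G_upper: "d i \<le> G X" if "v i \<in> X" for i X
    unfolding G_def using that by (intro SUP_upper) simp
  have G_E: "inf (E n) (h n X) \<le> G X" for n X
  proof (subst points, rule SUP_least)
    fix x assume "x \<in> X"
    then show "inf (E n) (h n {x}) \<le> G X"
      using G_upper[of "Some (n, x)"] by (simp add: d_simps v_simps)
  qed
  have G_eq: "G X = sup (if 0 \<in> X then C else bot) (SUP n. inf (E n) (h n X))" for X
  proof (rule order.antisym)
    show "G X \<le> sup (if 0 \<in> X then C else bot) (SUP n. inf (E n) (h n X))"
      unfolding G_def
    proof (rule SUP_least)
      fix i assume i: "i \<in> {i. v i \<in> X}"
      show "d i \<le> sup (if 0 \<in> X then C else bot) (SUP n. inf (E n) (h n X))"
      proof (cases i)
        case None
        then show ?thesis using i by (simp add: d_simps v_simps)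
      next
        case (Some nx)
        obtain n x where nx: "nx = (n, x)" by (cases nx)
        have "inf (E n) (h n {x}) \<le> inf (E n) (h n X)"
          using i Some nx by (subst (2) points) (rule SUP_upper, simp add: v_simps)
        then have "inf (E n) (h n {x}) \<le> (SUP n. inf (E n) (h n X))"
          by (rule order_trans) (intro SUP_upper UNIV_I)
        then show ?thesis using Some nx by (simp add: d_simps le_supI2)
      qed
    qed
    show "sup (if 0 \<in> X then C else bot) (SUP n. inf (E n) (h n X)) \<le> G X"
      using G_upper[of None X] by (auto intro!: SUP_least G_E simp: d_simps v_simps)
  qed
  have "(SUP i. d i) = top"
  proof -
    have "G UNIV = sup C (SUP n. inf (E n) (h n UNIV))" by (simp add: G_eq)
    also have "\<dots> = top"
      using compl(2) frame_homD(1)[OF real_continuous_frame_hom[OF h]] by (simp add: sup_commute)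
    finally show ?thesis by (simp add: G_def)
  qed
  then have "frame_hom G"
    unfolding G_def
  proof (rule frame_hom_glue)
    have C_E: "inf C (inf (E n) a) = bot" for n a
    proof -
      have "inf C (inf (E n) a) \<le> inf (SUP n. E n) C"
        by (intro le_infI inf.coboundedI1 inf.coboundedI2 SUP_upper) auto
      then show ?thesis using compl(1) by (simp add: bot_unique)
    qed
    fix i j assume "v i \<noteq> v j"
    then show "inf (d i) (d j) = bot"
      using C_E agree by (cases i; cases j) (auto simp: d_simps v_simps inf_commute[of _ C])
  qed
  moreover have "G {p<..<q} \<in> T" if "p \<in> \<rat>" "q \<in> \<rat>" for p q
  proof -
    have "h n {p<..<q} \<in> T" for n using h that by (simp add: real_continuous_def)
    then show ?thesis
      unfolding G_eq using CT subframeD(2)[OF T]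
      by (intro subframeD(4,5)[OF T] subframeD(3)[OF T] ET) auto
  qed
  ultimately show ?thesis using G_E by (auto simp: real_continuous_def)
qed

text \<open>
  The elements on which a homomorphism coincides with multiplication by \<open>g\<close> form an ideal.
\<close>

lemma (in cring) ideal_hom_eq_mult:
  assumes S: "S \<subseteq> carrier R" and h: "ideal_hom R (Idl S) h" and g: "g \<in> carrier R"
    and gen: "\<And>s. s \<in> S \<Longrightarrow> h s = s \<otimes> g" and x: "x \<in> Idl S"
  shows "h x = x \<otimes> g"
proof -
  interpret I: ideal "Idl S" R by (rule genideal_ideal[OF S])
  let ?J = "{x \<in> Idl S. h x = x \<otimes> g}"
  have add: "h (x \<oplus> y) = h x \<oplus> h y" if "x \<in> Idl S" "y \<in> Idl S" for x y
    using h that by (simp add: ideal_hom_def)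
  have mult: "h (a \<otimes> x) = a \<otimes> h x" if "a \<in> carrier R" "x \<in> Idl S" for a x
    using h that by (simp add: ideal_hom_def)
  have J_mult: "a \<otimes> x \<in> ?J" if "a \<in> carrier R" "x \<in> ?J" for a x
    using that g I.I_l_closed by (auto simp: mult m_assoc I.Icarr)
  have "ideal ?J R"
  proof (rule idealI)
    show "ring R" by (rule ring_axioms)
    show "subgroup ?J (add_monoid R)"
    proof
      show "?J \<subseteq> carrier (add_monoid R)" by (auto simp: I.Icarr)
      show "x \<otimes>\<^bsub>add_monoid R\<^esub> y \<in> ?J" if "x \<in> ?J" "y \<in> ?J" for x y
        using that g by (auto simp: add l_distr I.Icarr)
      have zero: "\<zero> \<in> Idl S" by (rule I.zero_closed)
      then have "h \<zero> \<in> carrier R" using h by (auto simp: ideal_hom_def)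
      then have "h \<zero> = \<zero>" using mult[OF zero_closed zero] by simp
      then show "\<one>\<^bsub>add_monoid R\<^esub> \<in> ?J" using zero g by simp
      fix x assume "x \<in> ?J"
      then have "\<ominus> \<one> \<otimes> x \<in> ?J" "x \<in> carrier R" using J_mult[of "\<ominus> \<one>" x] by (auto simp: I.Icarr)
      then have "\<ominus> x \<in> ?J" by (simp add: l_minus)
      then show "inv\<^bsub>add_monoid R\<^esub> x \<in> ?J" by (simp add: a_inv_def)
    qed
    show "a \<otimes> x \<in> ?J" if "x \<in> ?J" "a \<in> carrier R" for a x
      using J_mult that by blast
    then show "x \<otimes> a \<in> ?J" if "x \<in> ?J" "a \<in> carrier R" for a x
      using that m_comm[of x a] by (auto simp: I.Icarr)
  qed
  moreover have "S \<subseteq> ?J" using gen genideal_self[OF S] by auto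
  ultimately have "Idl S \<subseteq> ?J" by (rule genideal_minimal)
  then show ?thesis using x by blast
qed

lemma regular_rc_ring_imp_multiplier:
  fixes T :: "'a::frame set"
  assumes T: "topoframe T" and reg: "regular_cring (rc_ring T)"
    and I: "countably_generated_ideal (rc_ring T) I" and hom: "ideal_hom (rc_ring T) I h"
  shows "\<exists>g\<in>carrier (rc_ring T). \<forall>x\<in>I. h x = x \<otimes>\<^bsub>rc_ring T\<^esub> g"
proof -
  let ?R = "rc_ring T"
  interpret cring ?R by (rule cring_rc_ring[OF T])
  have sT: "subframe T" using T by (simp add: topoframe_def)
  obtain S where S: "countable S" "S \<subseteq> carrier ?R" and I_eq: "I = Idl\<^bsub>?R\<^esub> S"
    using I by (auto simp: countably_generated_ideal_def)
  interpret I: ideal I ?R unfolding I_eq by (rule genideal_ideal[OF S(2)])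
  \<comment> \<open>Adding \<open>0\<close> to the generators makes them the range of a sequence even if there are none.\<close>
  define s where "s = from_nat_into (insert \<zero>\<^bsub>?R\<^esub> S)"
  have range_s: "range s = insert \<zero>\<^bsub>?R\<^esub> S"
    unfolding s_def using S(1) by (intro range_from_nat_into) auto
  have sI: "s n \<in> I" for n
  proof -
    have "s n \<in> insert \<zero>\<^bsub>?R\<^esub> S" using range_s by blast
    then show ?thesis using genideal_self[OF S(2)] I.zero_closed by (auto simp: I_eq)
  qed
  have hI: "h x \<in> carrier ?R" if "x \<in> I" for x
    using hom that by (auto simp: ideal_hom_def)
  have h_mult: "h (a \<otimes>\<^bsub>?R\<^esub> x) = a \<otimes>\<^bsub>?R\<^esub> h x" if "a \<in> carrier ?R" "x \<in> I" for a x
    using hom that by (simp add: ideal_hom_def)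
  have sR: "real_continuous T (s n)" for n
    using I.Icarr[OF sI[of n]] by (simp add: rc_ring_simps)
  have "\<exists>t. real_continuous T t \<and> s n = rc_lift (*) (rc_lift (*) (s n) (s n)) t" for n
    by (rule regular_rc_ringD[OF reg sR])
  then obtain t where t: "\<And>n. real_continuous T (t n)"
    "\<And>n. s n = rc_lift (*) (rc_lift (*) (s n) (s n)) (t n)"
    by metis
  define e where "e n = rc_lift (*) (s n) (t n)" for n
  note supp = support_idempotent[OF T sR t, folded e_def]
  note idem = idempotent_values[OF supp(1,2)]
  have eI: "e n \<in> I" for n
    using I.I_r_closed[OF sI[of n], of "t n"] t(1)[of n] by (simp add: e_def rc_ring_simps)
  have heR: "real_continuous T (h (e n))" for n
    using hI[OF eI[of n]] by (simp add: rc_ring_simps)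
  obtain C where C: "C \<in> T" "inf (SUP n. e n {1}) C = bot" "sup (SUP n. e n {1}) C = top"
    using countable_join_complement[OF T reg, of "\<lambda>n. e n {1}" "\<lambda>n. e n {0}"] idem by blast
  \<comment> \<open>Both sides of \<open>e\<^sub>n (h e\<^sub>m) = e\<^sub>m (h e\<^sub>n)\<close> are evaluated where \<open>e\<^sub>m\<close> and \<open>e\<^sub>n\<close> are \<open>1\<close>.\<close>
  have agree: "inf (inf (e m {1}) (h (e m) {x})) (inf (e n {1}) (h (e n) {y})) = bot"
    if "x \<noteq> y" for m n x y
  proof -
    let ?a = "inf (inf (e m {1}) (h (e m) {x})) (inf (e n {1}) (h (e n) {y}))"
    have "e n \<otimes>\<^bsub>?R\<^esub> h (e m) = e m \<otimes>\<^bsub>?R\<^esub> h (e n)"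
      using h_mult[of "e n" "e m"] h_mult[of "e m" "e n"] eI m_comm[of "e n" "e m"]
      by (simp add: I.Icarr)
    then have eq: "rc_lift (*) (e n) (h (e m)) = rc_lift (*) (e m) (h (e n))"
      by (simp add: rc_ring_simps)
    have le: "?a \<le> e m {1}" "?a \<le> h (e m) {x}" "?a \<le> e n {1}" "?a \<le> h (e n) {y}"
      by (simp_all add: le_infI1 le_infI2)
    show ?thesis
    proof (rule value_unique)
      show "frame_hom (rc_lift (*) (e n) (h (e m)))"
        using supp(1) heR by (intro frame_hom_rc_lift real_continuous_frame_hom)
      show "?a \<le> rc_lift (*) (e n) (h (e m)) {x}"
        using rc_lift_value[of ?a "e n" 1 "h (e m)" x "(*)", OF le(3,2)] by simp
      show "?a \<le> rc_lift (*) (e n) (h (e m)) {y}"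
        using rc_lift_value[of ?a "e m" 1 "h (e n)" y "(*)", OF le(1,4)] eq by simp
    qed (rule that)
  qed
  have "\<exists>g. real_continuous T g \<and> (\<forall>n x. inf (e n {1}) (h (e n) {x}) \<le> g {x})"
    by (rule glue_real_continuous[OF sT idem(2) C heR agree])
  then obtain g where g: "real_continuous T g" "\<And>n x. inf (e n {1}) (h (e n) {x}) \<le> g {x}"
    by blast
  \<comment> \<open>Where \<open>s\<^sub>n\<close> is zero both products vanish; elsewhere \<open>e\<^sub>n\<close> is \<open>1\<close> and \<open>g\<close> was glued from \<open>h e\<^sub>n\<close>.\<close>
  have "rc_lift (*) (s n) (h (e n)) = rc_lift (*) (s n) g" for n
  proof -
    note homs = real_continuous_frame_hom[OF sR[of n]] real_continuous_frame_hom[OF g(1)]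
      real_continuous_frame_hom[OF heR[of n]]
    show ?thesis
    proof (rule frame_hom_eq_by_values[OF homs])
      fix x y z a assume a: "a \<noteq> bot" "a \<le> s n {x}" "a \<le> g {y}" "a \<le> h (e n) {z}"
      have "x * z = x * y"
      proof (cases "x = 0")
        case False
        have "a \<le> g {z}"
          using supp(5)[OF False, of n] a(2,4) g(2)[of n z] by (meson le_inf_iff order_trans)
        then show ?thesis using value_unique[OF homs(2)] a(1,3) by metis
      qed simp
      then show "\<exists>r. a \<le> rc_lift (*) (s n) (h (e n)) {r} \<and> a \<le> rc_lift (*) (s n) g {r}"
        using rc_lift_value[of a "s n" x "h (e n)" z "(*)", OF a(2,4)]
          rc_lift_value[of a "s n" x g y "(*)", OF a(2,3)] by auto
    qed (intro frame_hom_rc_lift homs)+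
  qed
  moreover have "h (s n) = rc_lift (*) (s n) (h (e n))" for n
    using h_mult[OF I.Icarr[OF sI[of n]] eI[of n]] supp(3)[of n] by (simp add: rc_ring_simps)
  ultimately have gen: "h (s n) = s n \<otimes>\<^bsub>?R\<^esub> g" for n by (simp add: rc_ring_simps)
  have gR: "g \<in> carrier ?R" using g(1) by (simp add: rc_ring_simps)
  have "h x = x \<otimes>\<^bsub>?R\<^esub> g" if "x \<in> I" for x
  proof (rule ideal_hom_eq_mult[OF S(2) hom[unfolded I_eq] gR])
    fix y assume "y \<in> S"
    then obtain n where "y = s n" using range_s by blast
    then show "h y = y \<otimes>\<^bsub>?R\<^esub> g" using gen by simp
  qed (use that I_eq in simp)
  then show ?thesis using gR by blast
qed

theorem corollary4:
  fixes T :: "'a::frame set"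
  assumes "topoframe T"
  shows "regular_cring (rc_ring T) \<longleftrightarrow> aleph0_selfinjective (rc_ring T)"
proof
  interpret cring "rc_ring T" by (rule cring_rc_ring[OF assms])
  show "regular_cring (rc_ring T)" if "aleph0_selfinjective (rc_ring T)"
  proof (rule reduced_selfinjective_imp_regular[OF _ that])
    fix f assume "f \<in> carrier (rc_ring T)" "f \<otimes>\<^bsub>rc_ring T\<^esub> f = \<zero>\<^bsub>rc_ring T\<^esub>"
    then show "f = \<zero>\<^bsub>rc_ring T\<^esub>"
      by (simp add: rc_ring_simps rc_ring_reduced real_continuous_frame_hom)
  qed
  assume reg: "regular_cring (rc_ring T)"
  show "aleph0_selfinjective (rc_ring T)"
  proof
    fix I h assume I: "countably_generated_ideal (rc_ring T) I" and h: "ideal_hom (rc_ring T) I h"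
    obtain g where g: "g \<in> carrier (rc_ring T)" "\<forall>x\<in>I. h x = x \<otimes>\<^bsub>rc_ring T\<^esub> g"
      using regular_rc_ring_imp_multiplier[OF assms reg I h] by blast
    have "ideal_hom (rc_ring T) (carrier (rc_ring T)) (\<lambda>x. x \<otimes>\<^bsub>rc_ring T\<^esub> g)"
      using g(1) by (auto simp: ideal_hom_def l_distr m_assoc)
    then show "\<exists>k. ideal_hom (rc_ring T) (carrier (rc_ring T)) k \<and> (\<forall>x\<in>I. k x = h x)"
      using g(2) by auto
  qed
qed

end
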